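(* Let $K$ be an algebraic number field of odd degree $n=[K:\mathbb{Q}]\ge 3$ such that $K/\mathbb{Q}$ is a Galois extension, with ring of integers $\mathcal{O}_K$. Let $p$ be a prime number and write $p\mathcal{O}_K=P_1^{e}P_2^{e}\cdots P_g^{e}$ with positive integers $g,e$ and pairwise distinct prime ideals $P_1,\dots,P_g$ of $\mathcal{O}_K$. If $p\mathcal{O}_K$ is ramified (i.e. $e>1$), then $$\frac{e}{e+1}\ge \frac{\tau^{(e)}(p\mathcal{O}_K)}{\tau(p\mathcal{O}_K)}+\frac{1}{\omega(p\mathcal{O}_K)}\cdot\frac{g}{e+1}.$$
   Context: For a positive integer $m$, $\tau(m)$ is the number of positive divisors of $m$. If $J=P_1^{e_1}\cdots P_g^{e_g}$ is the factorization of a nonzero proper ideal $J$ of $\mathcal{O}_K$ into pairwise distinct nonzero prime ideals with positive exponents, then $\tau(J)$ is the number of ideals $P_1^{a_1}\cdots P_g^{a_g}$ with $0\le a_i\le e_i$ (so $\tau(J)=\prod_i(e_i+1)$); $\tau^{(e)}(J)$ is the number of exponential divisors of $J$, i.e. ideals $P_1^{b_1}\cdots P_g^{b_g}$ with positive integers $b_i\mid e_i$ (so $\tau^{(e)}(J)=\prod_i\tau(e_i)$); and $\omega(J)=g$. *)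

theory Defs
  imports
    "HOL-Algebra.Ideal_Product"
    "HOL-Algebra.Algebraic_Closure_Type"
    "HOL-Computational_Algebra.Computational_Algebra"
begin

section \<open>Number fields\<close>

text \<open>
  A field \<open>K\<close> of characteristic 0 is a type of class \<open>field_char_0\<close>, so that the prime field
  \<open>\<rat>\<close> is embedded by \<open>of_rat\<close>. Properties of the extension \<open>K/\<rat>\<close> are predicates on
  \<open>TYPE('k)\<close>.
\<close>

definition rat_scale :: "rat \<Rightarrow> 'k \<Rightarrow> 'k::field_char_0" where
  "rat_scale q x = of_rat q * x"

lemma vector_space_rat_scale: "vector_space rat_scale"
  by unfold_locales (simp_all add: rat_scale_def algebra_simps of_rat_add of_rat_mult)

definition number_field :: "'k::field_char_0 itself \<Rightarrow> bool" where
  "number_field K \<longleftrightarrow>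
     (\<exists>B::'k set. finite B \<and> module.span rat_scale B = UNIV)"

definition degree_over_rat :: "'k::field_char_0 itself \<Rightarrow> nat" where
  "degree_over_rat K = vector_space.dim rat_scale (UNIV :: 'k set)"

definition splits_into_linear_factors :: "'k::field poly \<Rightarrow> bool" where
  "splits_into_linear_factors f \<longleftrightarrow> (\<exists>c as. f = smult c (\<Prod>a\<leftarrow>as. [:- a, 1:]))"

text \<open>
  An irreducible rational polynomial with a root \<open>x\<close> in \<open>K\<close> is, up to a unit, the minimal
  polynomial of \<open>x\<close>.
\<close>

definition normal_over_rat :: "'k::field_char_0 itself \<Rightarrow> bool" where
  "normal_over_rat K \<longleftrightarrow>
     (\<forall>f :: rat poly. irreducible f \<longrightarrow> (\<exists>x::'k. poly (map_poly of_rat f) x = 0) \<longrightarrow>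
        splits_into_linear_factors (map_poly of_rat f :: 'k poly))"

definition separable_over_rat :: "'k::field_char_0 itself \<Rightarrow> bool" where
  "separable_over_rat K \<longleftrightarrow>
     (\<forall>f :: rat poly. irreducible f \<longrightarrow> (\<exists>x::'k. poly (map_poly of_rat f) x = 0) \<longrightarrow>
        coprime f (pderiv f))"

definition algebraic_over_rat :: "'k::field_char_0 itself \<Rightarrow> bool" where
  "algebraic_over_rat K \<longleftrightarrow> (\<forall>x::'k. \<exists>f :: rat poly. f \<noteq> 0 \<and> poly (map_poly of_rat f) x = 0)"

definition galois_over_rat :: "'k::field_char_0 itself \<Rightarrow> bool" where
  "galois_over_rat K \<longleftrightarrow>
     algebraic_over_rat K \<and> normal_over_rat K \<and> separable_over_rat K"

definition ring_of_integers :: "'k::field_char_0 ring" where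
  "ring_of_integers = ring_of_type_algebra \<lparr> carrier := {x. algebraic_int x} \<rparr>"


section \<open>Divisor functions on ideals\<close>

text \<open>
  A factorization into prime ideals is given by its exponent function, which is zero outside a
  finite set of nonzero prime ideals. Products and powers of ideals are those of the monoid
  \<open>ideals_set R\<close>.
\<close>

definition ideal_prime_support :: "('a set \<Rightarrow> nat) \<Rightarrow> 'a set set" where
  "ideal_prime_support v = {P. v P > 0}"

definition prime_power_product ::
    "('a, 'b) ring_scheme \<Rightarrow> 'a set set \<Rightarrow> ('a set \<Rightarrow> nat) \<Rightarrow> 'a set" where
  "prime_power_product R S v = (\<Otimes>\<^bsub>ideals_set R\<^esub> P\<in>S. P [^]\<^bsub>ideals_set R\<^esub> v P)"

definition is_prime_factorization ::
    "('a, 'b) ring_scheme \<Rightarrow> 'a set \<Rightarrow> ('a set \<Rightarrow> nat) \<Rightarrow> bool" where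
  "is_prime_factorization R J v \<longleftrightarrow>
     finite (ideal_prime_support v) \<and>
     (\<forall>P\<in>ideal_prime_support v. primeideal P R \<and> P \<noteq> {\<zero>\<^bsub>R\<^esub>}) \<and>
     J = prime_power_product R (ideal_prime_support v) v"

text \<open>Well defined for nonzero ideals of a Dedekind domain, by unique factorization.\<close>

definition prime_exponent :: "('a, 'b) ring_scheme \<Rightarrow> 'a set \<Rightarrow> 'a set \<Rightarrow> nat" where
  "prime_exponent R J = (THE v. is_prime_factorization R J v)"

definition ideal_prime_divisors :: "('a, 'b) ring_scheme \<Rightarrow> 'a set \<Rightarrow> 'a set set" where
  "ideal_prime_divisors R J = ideal_prime_support (prime_exponent R J)"

definition ideal_omega :: "('a, 'b) ring_scheme \<Rightarrow> 'a set \<Rightarrow> nat" where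
  "ideal_omega R J = card (ideal_prime_divisors R J)"

definition ideal_tau :: "('a, 'b) ring_scheme \<Rightarrow> 'a set \<Rightarrow> nat" where
  "ideal_tau R J = card {prime_power_product R (ideal_prime_divisors R J) a | a.
     \<forall>P\<in>ideal_prime_divisors R J. a P \<le> prime_exponent R J P}"

definition ideal_tau_exponential :: "('a, 'b) ring_scheme \<Rightarrow> 'a set \<Rightarrow> nat" where
  "ideal_tau_exponential R J = card {prime_power_product R (ideal_prime_divisors R J) b | b.
     \<forall>P\<in>ideal_prime_divisors R J. b P > 0 \<and> b P dvd prime_exponent R J P}"

end

theory Submission
  imports Defs "Jordan_Normal_Form.Determinant"
begin

text \<open>
  Every ideal dividing \<open>(p)\<close> is invertible. Invertible ideals can be cancelled and invertible prime
  ideals are incomparable, so the factorization of \<open>(p)\<close> is unique.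
  Hence \<open>\<omega> = g\<close>, \<open>\<tau> = (e + 1)^g\<close> and \<open>\<tau>\<^sup>e = \<tau>(e)^g\<close>, and the claim becomes
  \<open>(\<tau>(e) / (e + 1))^g \<le> (e - 1) / (e + 1)\<close>. For \<open>e \<ge> 3\<close> it follows from \<open>\<tau>(e) \<le> e - 1\<close>,
  because \<open>e - 1\<close> does not divide \<open>e\<close>. For \<open>e = 2\<close> it holds if \<open>g \<ge> 3\<close>.

  It remains to show that \<open>(p) = I^2\<close> with at most two primes dividing \<open>I\<close> forces an even degree.
  Choose \<open>x \<in> I\<close> outside \<open>I Q\<close> for each prime
  \<open>Q\<close> dividing \<open>I\<close>. Then \<open>x^2 = p y\<close> with \<open>y\<close> outside each \<open>Q\<close>, and such a \<open>y\<close> divides an integer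
  \<open>m\<close> prime to \<open>p\<close>. Norms of algebraic integers are integers, because the powers of an algebraic
  integer have bounded denominators. So \<open>N(x)^2 = p^n N(y)\<close> with \<open>N(y)\<close> dividing \<open>m^n\<close>, and
  comparing exponents of \<open>p\<close> shows that \<open>n\<close> is even.
\<close>

section \<open>Invertible ideals and unique factorization\<close>

text \<open>This is invertibility as a fractional ideal, with inverse \<open>J\<close> divided by
  \<open>a\<close>, expressed inside the ring.\<close>

definition invertible_ideal :: "('a, 'b) ring_scheme \<Rightarrow> 'a set \<Rightarrow> bool" where
  "invertible_ideal R I \<longleftrightarrow> ideal I R \<and>
     (\<exists>J a. ideal J R \<and> a \<in> carrier R \<and> a \<noteq> \<zero>\<^bsub>R\<^esub> \<and> ideal_prod R I J = PIdl\<^bsub>R\<^esub> a)"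

lemma ideals_set_simps [simp]:
  "carrier (ideals_set R) = {I. ideal I R}"
  "monoid.mult (ideals_set R) = ideal_prod R"
  "monoid.one (ideals_set R) = carrier R"
  by (simp_all add: ideals_set_def)

lemma ideal_prod_mono:
  assumes "I \<subseteq> I'" "J \<subseteq> J'"
  shows "ideal_prod R I J \<subseteq> ideal_prod R I' J'"
proof
  fix x assume "x \<in> ideal_prod R I J"
  then show "x \<in> ideal_prod R I' J'"
    by induction (use assms in \<open>auto intro: ideal_prod.intros\<close>)
qed

section \<open>Products and powers of ideals in a commutative ring\<close>

context cring
begin

text \<open>A multiple of \<open>a\<close> times an element of \<open>I\<close> is \<open>a\<close>
  times another element of \<open>I\<close>, and a common factor \<open>a\<close> can be pulled out
  of sums. So no finite sums of products remain.\<close>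

lemma cgenideal_mult_mem:
  assumes a: "a \<in> carrier R" and I: "ideal I R"
  shows "x \<in> (PIdl a) \<cdot> I \<longleftrightarrow> (\<exists>y\<in>I. x = a \<otimes> y)"
proof
  interpret I: ideal I R by fact
  assume "x \<in> (PIdl a) \<cdot> I"
  then show "\<exists>y\<in>I. x = a \<otimes> y"
  proof induction
    case (prod i j)
    then obtain r where r: "r \<in> carrier R" "i = r \<otimes> a" by (auto simp: cgenideal_def)
    with prod a have "i \<otimes> j = a \<otimes> (r \<otimes> j)" by (metis I.a_Hcarr m_assoc m_comm)
    with r prod show ?case by (metis I.I_l_closed)
  next
    case (sum s1 s2)
    then show ?case using a by (metis I.a_closed I.a_Hcarr r_distr)
  qed
next
  assume "\<exists>y\<in>I. x = a \<otimes> y"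
  then show "x \<in> (PIdl a) \<cdot> I"
    using cgenideal_self[OF a] by (auto intro: ideal_prod.prod)
qed

lemma invertible_ideal_factors:
  assumes "ideal I R" "ideal J R" "a \<in> carrier R" "a \<noteq> \<zero>" "I \<cdot> J = PIdl a"
  shows "invertible_ideal R I" "invertible_ideal R J"
  using assms ideal_prod_commute[of I J] unfolding invertible_ideal_def by auto

lemma ideals_finprod_ideal:
  assumes "\<And>i. i \<in> S \<Longrightarrow> ideal (f i) R"
  shows "ideal (\<Otimes>\<^bsub>ideals_set R\<^esub> i\<in>S. f i) R"
proof -
  interpret M: comm_monoid "ideals_set R" by (rule ideals_set_is_comm_monoid)
  show ?thesis using M.finprod_closed[of f S] assms by auto
qed

lemma ideals_pow_ideal: "ideal I R \<Longrightarrow> ideal (I [^]\<^bsub>ideals_set R\<^esub> (k::nat)) R"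
proof -
  interpret M: comm_monoid "ideals_set R" by (rule ideals_set_is_comm_monoid)
  show "ideal I R \<Longrightarrow> ideal (I [^]\<^bsub>ideals_set R\<^esub> k) R" using M.nat_pow_closed[of I k] by simp
qed

lemma ideals_finprod_subset:
  assumes S: "finite S" "i \<in> S" and f: "\<And>i. i \<in> S \<Longrightarrow> ideal (f i) R"
  shows "(\<Otimes>\<^bsub>ideals_set R\<^esub> i\<in>S. f i) \<subseteq> f i"
proof -
  interpret M: comm_monoid "ideals_set R" by (rule ideals_set_is_comm_monoid)
  let ?F = "\<Otimes>\<^bsub>ideals_set R\<^esub> i\<in>S - {i}. f i"
  have F: "ideal ?F R" using f by (intro ideals_finprod_ideal) auto
  have "(\<Otimes>\<^bsub>ideals_set R\<^esub> i\<in>insert i (S - {i}). f i) = f i \<cdot> ?F"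
    using S f by (subst M.finprod_insert) auto
  also have "\<dots> \<subseteq> f i" using ideal_prod_inter[OF f[OF S(2)] F] by blast
  finally show ?thesis using S by (simp add: insert_absorb)
qed

lemma prime_contains_pow:
  assumes P: "primeideal P R" and I: "ideal I R" and "I [^]\<^bsub>ideals_set R\<^esub> (k::nat) \<subseteq> P"
  shows "k > 0 \<and> I \<subseteq> P"
  using assms(3)
proof (induction k)
  case 0
  then show ?case using primeideal.I_notcarr[OF P] primeideal.axioms(1)[OF P]
    by (auto dest: ideal.Icarr)
next
  case (Suc k)
  from Suc.prems have "(I [^]\<^bsub>ideals_set R\<^esub> k) \<cdot> I \<subseteq> P" by simp
  from primeideal_divides_ideal_prod[OF P ideals_pow_ideal[OF I] I this] Suc.IH show ?case by auto
qed

lemma prime_contains_finprod: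
  assumes P: "primeideal P R" and "finite S" and "\<And>i. i \<in> S \<Longrightarrow> ideal (f i) R"
    and "(\<Otimes>\<^bsub>ideals_set R\<^esub> i\<in>S. f i) \<subseteq> P"
  shows "\<exists>i\<in>S. f i \<subseteq> P"
  using assms(2-4)
proof (induction S)
  case empty
  interpret M: comm_monoid "ideals_set R" by (rule ideals_set_is_comm_monoid)
  from empty show ?case using primeideal.I_notcarr[OF P] primeideal.axioms(1)[OF P]
    by (auto dest: ideal.Icarr)
next
  case (insert i S)
  interpret M: comm_monoid "ideals_set R" by (rule ideals_set_is_comm_monoid)
  have "f i \<cdot> (\<Otimes>\<^bsub>ideals_set R\<^esub> i\<in>S. f i) \<subseteq> P"
    using insert by (subst (asm) M.finprod_insert) auto
  from primeideal_divides_ideal_prod[OF P _ ideals_finprod_ideal this] insert show ?case by auto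
qed

end

section \<open>Cancellation of and division by invertible ideals in a domain\<close>

context "domain"
begin

lemma invertible_ideal_cgenideal:
  assumes "a \<in> carrier R" "a \<noteq> \<zero>"
  shows "invertible_ideal R (PIdl a)"
  unfolding invertible_ideal_def
  using assms cgenideal_ideal oneideal ideal_prod_one by metis

lemma cgenideal_cancel_subset:
  assumes a: "a \<in> carrier R" "a \<noteq> \<zero>" and I: "ideal I R" and J: "ideal J R"
    and sub: "(PIdl a) \<cdot> I \<subseteq> (PIdl a) \<cdot> J"
  shows "I \<subseteq> J"
proof
  fix x assume x: "x \<in> I"
  with sub have "a \<otimes> x \<in> (PIdl a) \<cdot> J" using cgenideal_mult_mem[OF a(1) I] by blast
  then obtain y where "y \<in> J" "a \<otimes> x = a \<otimes> y" using cgenideal_mult_mem[OF a(1) J] by blast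
  with a x I J show "x \<in> J" by (metis ideal.Icarr m_lcancel)
qed

text \<open>Multiplying by the cofactor \<open>J\<close> turns \<open>I\<close> into the principal
  ideal of \<open>a\<close>, which cancels because the element \<open>a\<close> does.\<close>

lemma invertible_ideal_cancel_subset:
  assumes "invertible_ideal R I" and V: "ideal V R" and Y: "ideal Y R" and sub: "I \<cdot> V \<subseteq> I \<cdot> Y"
  shows "V \<subseteq> Y"
proof -
  obtain J a where J: "ideal J R" and a: "a \<in> carrier R" "a \<noteq> \<zero>" and IJ: "I \<cdot> J = PIdl a"
    and I: "ideal I R" using assms unfolding invertible_ideal_def by auto
  have "J \<cdot> (I \<cdot> V) \<subseteq> J \<cdot> (I \<cdot> Y)" by (rule ideal_prod_mono[OF subset_refl sub])
  moreover have "J \<cdot> (I \<cdot> Z) = (PIdl a) \<cdot> Z" if "ideal Z R" for Z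
    using ideal_prod_assoc[OF J I that] ideal_prod_commute[OF I J] IJ by simp
  ultimately have "(PIdl a) \<cdot> V \<subseteq> (PIdl a) \<cdot> Y" using V Y by simp
  then show ?thesis by (rule cgenideal_cancel_subset[OF a V Y])
qed

lemma invertible_ideal_cancel:
  assumes "invertible_ideal R I" "ideal V R" "ideal Y R" "I \<cdot> V = I \<cdot> Y"
  shows "V = Y"
  using invertible_ideal_cancel_subset[of I V Y] invertible_ideal_cancel_subset[of I Y V] assms by auto

text \<open>To contain is to divide: the quotient is \<open>V\<close> times the inverse of
  \<open>I\<close>. It lies in the ring because \<open>V \<cdot> J\<close> is contained in
  \<open>I \<cdot> J\<close>, so \<open>a\<close> divides all its elements.\<close>

lemma invertible_ideal_divides:
  assumes inv: "invertible_ideal R I" and V: "ideal V R" and sub: "V \<subseteq> I"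
  obtains Y where "ideal Y R" "V = I \<cdot> Y"
proof -
  obtain J a where J: "ideal J R" and a: "a \<in> carrier R" "a \<noteq> \<zero>" and IJ: "I \<cdot> J = PIdl a"
    and I: "ideal I R" using assms unfolding invertible_ideal_def by auto
  \<comment> \<open>This is the ideal \<open>V \<cdot> J\<close> divided by
    \<open>a\<close>.\<close>
  define Y where "Y = {y \<in> carrier R. a \<otimes> y \<in> V \<cdot> J}"
  interpret XJ: ideal "V \<cdot> J" R using V J by (rule ideal_prod_is_ideal)
  have Y: "ideal Y R"
  proof (rule idealI)
    show "subgroup Y (add_monoid R)"
    proof (rule add.subgroupI)
      show "Y \<noteq> {}" using a XJ.zero_closed by (auto simp: Y_def intro!: exI[of _ \<zero>])
    qed (use a in \<open>auto simp: Y_def r_distr r_minus simp flip: a_inv_def\<close>)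
  next
    fix y x assume "y \<in> Y" "x \<in> carrier R"
    then have "a \<otimes> (y \<otimes> x) \<in> V \<cdot> J" using a XJ.I_r_closed[of "a \<otimes> y" x]
      by (simp add: Y_def m_assoc)
    then show "x \<otimes> y \<in> Y" "y \<otimes> x \<in> Y"
      using \<open>y \<in> Y\<close> \<open>x \<in> carrier R\<close> by (auto simp: Y_def m_comm)
  qed (rule ring_axioms)
  have "V \<cdot> J \<subseteq> PIdl a" unfolding IJ[symmetric] using sub by (intro ideal_prod_mono) auto
  have "V \<cdot> J = (PIdl a) \<cdot> Y"
  proof (intro Set.set_eqI iffI)
    fix x assume x: "x \<in> V \<cdot> J"
    with \<open>V \<cdot> J \<subseteq> PIdl a\<close> obtain r where "r \<in> carrier R" "x = a \<otimes> r"
      using a(1) by (auto simp: cgenideal_def m_comm)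
    with x show "x \<in> (PIdl a) \<cdot> Y" using a Y by (auto simp: cgenideal_mult_mem Y_def)
  next
    fix x assume "x \<in> (PIdl a) \<cdot> Y"
    then show "x \<in> V \<cdot> J" using a Y by (auto simp: cgenideal_mult_mem Y_def)
  qed
  then have "J \<cdot> V = J \<cdot> (I \<cdot> Y)"
    using ideal_prod_assoc[OF J I Y] ideal_prod_commute[OF I J] ideal_prod_commute[OF V J] IJ by simp
  then have "V = I \<cdot> Y"
    using invertible_ideal_factors(2)[OF I J a IJ] V ideal_prod_is_ideal[OF I Y]
      invertible_ideal_cancel by blast
  with Y that show ?thesis by blast
qed

text \<open>If \<open>Q\<close> is \<open>P\<close> times \<open>Y\<close>, primality of
  \<open>Q\<close> puts \<open>P\<close> or \<open>Y\<close> inside \<open>Q\<close>. In the second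
  case \<open>Y\<close> equals \<open>Q\<close>, and cancelling \<open>Q\<close> from
  \<open>Q = P \<cdot> Q\<close> would make \<open>P\<close> the whole ring.\<close>

lemma invertible_prime_eqI:
  assumes P: "primeideal P R" "invertible_ideal R P"
    and Q: "primeideal Q R" "invertible_ideal R Q" and "Q \<subseteq> P"
  shows "P = Q"
proof -
  have iP: "ideal P R" and iQ: "ideal Q R" using P Q primeideal.axioms(1) by auto
  obtain Y where Y: "ideal Y R" "Q = P \<cdot> Y"
    using invertible_ideal_divides[OF P(2) iQ \<open>Q \<subseteq> P\<close>] by metis
  consider "P \<subseteq> Q" | "Y \<subseteq> Q"
    using primeideal_divides_ideal_prod[OF Q(1) iP Y(1)] Y(2) by auto
  then show ?thesis
  proof cases
    case 1
    with \<open>Q \<subseteq> P\<close> show ?thesis by auto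
  next
    case 2
    have "Q \<subseteq> Y" unfolding Y(2) using ideal_prod_inter[OF iP Y(1)] by blast
    with 2 have "Y = Q" by (rule subset_antisym)
    have "Q \<cdot> carrier R = Q" by (rule ideal_prod_one[OF iQ])
    also have "\<dots> = Q \<cdot> P"
      using Y(2) unfolding \<open>Y = Q\<close> ideal_prod_commute[OF iP iQ] .
    finally have "carrier R = P" by (rule invertible_ideal_cancel[OF Q(2) oneideal iP])
    with P show ?thesis using primeideal.I_notcarr by blast
  qed
qed

lemma invertible_ideal_factor:
  assumes inv: "invertible_ideal R (I \<cdot> J)" and I: "ideal I R" and J: "ideal J R"
  shows "invertible_ideal R I" "invertible_ideal R J"
proof -
  obtain L a where L: "ideal L R" and a: "a \<in> carrier R" "a \<noteq> \<zero>" and eq: "(I \<cdot> J) \<cdot> L = PIdl a"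
    using inv unfolding invertible_ideal_def by auto
  have "I \<cdot> (J \<cdot> L) = PIdl a"
    by (simp only: ideal_prod_assoc[OF I J L, symmetric] eq)
  then show "invertible_ideal R I"
    by (rule invertible_ideal_factors(1)[OF I ideal_prod_is_ideal[OF J L] a])
  have "J \<cdot> (I \<cdot> L) = PIdl a"
    by (simp only: ideal_prod_assoc[OF J I L, symmetric] ideal_prod_commute[OF J I] eq)
  then show "invertible_ideal R J"
    by (rule invertible_ideal_factors(1)[OF J ideal_prod_is_ideal[OF I L] a])
qed

lemma invertible_ideal_mult:
  assumes "invertible_ideal R I" "invertible_ideal R J"
  shows "invertible_ideal R (I \<cdot> J)"
proof -
  obtain L a where I: "ideal I R" and L: "ideal L R" and a: "a \<in> carrier R" "a \<noteq> \<zero>" and IL: "I \<cdot> L = PIdl a"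
    using assms unfolding invertible_ideal_def by auto
  obtain M b where J: "ideal J R" and M: "ideal M R" and b: "b \<in> carrier R" "b \<noteq> \<zero>" and JM: "J \<cdot> M = PIdl b"
    using assms unfolding invertible_ideal_def by auto
  have "(I \<cdot> J) \<cdot> (L \<cdot> M) = I \<cdot> (L \<cdot> (J \<cdot> M))"
    by (simp only: ideal_prod_assoc[OF I J ideal_prod_is_ideal[OF L M]]
        ideal_prod_assoc[OF J L M, symmetric] ideal_prod_commute[OF J L] ideal_prod_assoc[OF L J M])
  also have "\<dots> = (PIdl a) \<cdot> (PIdl b)"
    using ideal_prod_assoc[OF I L ideal_prod_is_ideal[OF J M]] unfolding IL JM by (rule sym)
  also have "\<dots> = PIdl (a \<otimes> b)"
  proof (rule Set.set_eqI)
    fix x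
    have "x \<in> (PIdl a) \<cdot> (PIdl b) \<longleftrightarrow> (\<exists>y\<in>PIdl b. x = a \<otimes> y)"
      by (rule cgenideal_mult_mem[OF a(1) cgenideal_ideal[OF b(1)]])
    also have "\<dots> \<longleftrightarrow> (\<exists>r\<in>carrier R. x = a \<otimes> (r \<otimes> b))" by (auto simp: cgenideal_def)
    also have "\<dots> \<longleftrightarrow> x \<in> PIdl (a \<otimes> b)"
      using a b by (auto simp: cgenideal_def m_lcomm)
    finally show "x \<in> (PIdl a) \<cdot> (PIdl b) \<longleftrightarrow> x \<in> PIdl (a \<otimes> b)" .
  qed
  finally have "(I \<cdot> J) \<cdot> (L \<cdot> M) = PIdl (a \<otimes> b)" .
  then show ?thesis
    by (rule invertible_ideal_factors(1)[rotated -1])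
      (use a b in \<open>auto simp: integral_iff intro: ideal_prod_is_ideal I J L M\<close>)
qed

lemma invertible_ideal_pow:
  assumes "invertible_ideal R I"
  shows "invertible_ideal R (I [^]\<^bsub>ideals_set R\<^esub> (k::nat))"
proof (induction k)
  case 0
  have "carrier R = PIdl \<one>" by (auto simp: cgenideal_def, metis r_one)
  then show ?case using invertible_ideal_cgenideal[OF one_closed one_not_zero] by simp
next
  case (Suc k)
  then show ?case using assms by (simp add: invertible_ideal_mult)
qed

section \<open>Unique factorization into invertible primes\<close>

lemma prime_power_product_remove:
  assumes "finite S" "\<And>P. P \<in> S \<Longrightarrow> ideal P R" "Q \<in> S"
  shows "prime_power_product R S a =
    (Q [^]\<^bsub>ideals_set R\<^esub> a Q) \<cdot> prime_power_product R (S - {Q}) a"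
proof -
  interpret M: comm_monoid "ideals_set R" by (rule ideals_set_is_comm_monoid)
  have "prime_power_product R (insert Q (S - {Q})) a =
    (Q [^]\<^bsub>ideals_set R\<^esub> a Q) \<cdot> prime_power_product R (S - {Q}) a"
    unfolding prime_power_product_def
    using assms by (subst M.finprod_insert) (auto intro: ideals_pow_ideal)
  with \<open>Q \<in> S\<close> show ?thesis by (simp add: insert_absorb)
qed

lemma prime_power_product_ideal:
  assumes "\<And>P. P \<in> S \<Longrightarrow> ideal P R"
  shows "ideal (prime_power_product R S a) R"
  unfolding prime_power_product_def using assms
  by (intro ideals_finprod_ideal) (auto intro: ideals_pow_ideal)

text \<open>If the exponent of \<open>Q\<close> were larger on the right, cancelling the power
  \<open>a Q\<close> of \<open>Q\<close> would leave a factor \<open>Q\<close> there. Then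
  \<open>Q\<close> would contain the product of the other prime powers on the left, hence another
  prime of \<open>S\<close>, which incomparability forbids.\<close>

lemma prime_power_product_subset_imp_le:
  assumes S: "finite S" and prime: "\<And>P. P \<in> S \<Longrightarrow> primeideal P R"
    and inv: "\<And>P. P \<in> S \<Longrightarrow> invertible_ideal R P"
    and sub: "prime_power_product R S a \<subseteq> prime_power_product R S b" and Q: "Q \<in> S"
  shows "b Q \<le> a Q"
proof (rule ccontr)
  interpret M: comm_monoid "ideals_set R" by (rule ideals_set_is_comm_monoid)
  have ideal: "ideal P R" if "P \<in> S" for P using prime[OF that] by (rule primeideal.axioms)
  let ?A = "prime_power_product R (S - {Q}) a"
  let ?B = "prime_power_product R (S - {Q}) b"
  have iA: "ideal ?A R" and iB: "ideal ?B R"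
    using ideal by (auto intro!: prime_power_product_ideal)
  note pw = ideals_pow_ideal[OF ideal[OF Q]]
  assume "\<not> b Q \<le> a Q"
  then obtain k where k: "b Q = a Q + Suc k" using less_imp_Suc_add[of "a Q" "b Q"] by auto
  have "(Q [^]\<^bsub>ideals_set R\<^esub> a Q) \<cdot> ?A \<subseteq> (Q [^]\<^bsub>ideals_set R\<^esub> b Q) \<cdot> ?B"
    using sub S ideal Q by (simp add: prime_power_product_remove)
  also have "\<dots> = (Q [^]\<^bsub>ideals_set R\<^esub> a Q) \<cdot> ((Q [^]\<^bsub>ideals_set R\<^esub> Suc k) \<cdot> ?B)"
    using M.nat_pow_mult[of Q "a Q" "Suc k"] ideal[OF Q] ideal_prod_assoc[OF pw pw iB, of "a Q" "Suc k"]
    unfolding k ideals_set_simps mem_Collect_eq by metis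
  finally have "?A \<subseteq> (Q [^]\<^bsub>ideals_set R\<^esub> Suc k) \<cdot> ?B"
    by (rule invertible_ideal_cancel_subset[OF invertible_ideal_pow[OF inv[OF Q]] iA
          ideal_prod_is_ideal[OF pw iB]])
  also have "\<dots> \<subseteq> Q"
    using ideal_prod_inter[OF pw iB] ideal_prod_inter[OF pw ideal[OF Q]] by fastforce
  finally obtain P where P: "P \<in> S - {Q}" "P [^]\<^bsub>ideals_set R\<^esub> a P \<subseteq> Q"
    using prime_contains_finprod[OF prime[OF Q], of "S - {Q}" "\<lambda>P. P [^]\<^bsub>ideals_set R\<^esub> a P"]
      S ideal unfolding prime_power_product_def by (auto intro: ideals_pow_ideal)
  then have "P \<subseteq> Q" using prime_contains_pow[OF prime[OF Q], of P] ideal by auto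
  then show False using invertible_prime_eqI[of Q P] prime inv Q P by auto
qed

lemma prime_power_product_inj:
  assumes "finite S" "\<And>P. P \<in> S \<Longrightarrow> primeideal P R" "\<And>P. P \<in> S \<Longrightarrow> invertible_ideal R P"
    and "prime_power_product R S a = prime_power_product R S b" and "Q \<in> S"
  shows "a Q = b Q"
  using prime_power_product_subset_imp_le[of S a b Q] prime_power_product_subset_imp_le[of S b a Q]
    assms by auto

lemma prime_power_product_mono_neutral:
  assumes "finite T" "S \<subseteq> T" "\<And>P. P \<in> T \<Longrightarrow> ideal P R" "\<And>P. P \<in> T - S \<Longrightarrow> a P = 0"
  shows "prime_power_product R S a = prime_power_product R T a"
proof -
  interpret M: comm_monoid "ideals_set R" by (rule ideals_set_is_comm_monoid)
  show ?thesis unfolding prime_power_product_def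
    using assms by (intro M.finprod_mono_neutral_cong_left) (auto intro: ideals_pow_ideal)
qed

text \<open>Invertibility passes from a product to its factors: first to the power of
  \<open>P\<close>, then to \<open>P\<close> itself, since the exponent is positive on the
  support.\<close>

lemma prime_factorization_invertible:
  assumes "is_prime_factorization R J v" "invertible_ideal R J" "P \<in> ideal_prime_support v"
  shows "invertible_ideal R P"
proof -
  let ?S = "ideal_prime_support v"
  have S: "finite ?S" "\<And>P. P \<in> ?S \<Longrightarrow> ideal P R" and J: "J = prime_power_product R ?S v"
    using assms unfolding is_prime_factorization_def by (auto intro: primeideal.axioms)
  obtain k where k: "v P = Suc k"
    using assms(3) by (auto simp: ideal_prime_support_def gr0_conv_Suc)
  note pw = ideals_pow_ideal[OF S(2)[OF assms(3)]]
  have iX: "ideal (prime_power_product R (?S - {P}) v) R"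
    using S by (intro prime_power_product_ideal) auto
  have "invertible_ideal R (P [^]\<^bsub>ideals_set R\<^esub> v P)"
    by (rule invertible_ideal_factor[OF _ pw iX])
      (use assms(2) J prime_power_product_remove[of ?S P v] S assms(3) in metis)
  then show ?thesis
    unfolding k using invertible_ideal_factor(2)[OF _ pw S(2)[OF assms(3)]] by simp
qed

text \<open>This evaluates the definite description. Two factorizations become comparable as
  products over the union \<open>T\<close> of their supports, because exponents vanish outside the
  support and add only trivial factors.\<close>

lemma prime_exponent_eq:
  assumes J: "invertible_ideal R J" and v: "is_prime_factorization R J v"
  shows "prime_exponent R J = v"
  unfolding prime_exponent_def
proof (rule the_equality[where P = "is_prime_factorization R J", OF v], rule ext)
  fix w Q assume w: "is_prime_factorization R J w"
  define T where "T = ideal_prime_support v \<union> ideal_prime_support w"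
  have T: "finite T" "primeideal P R" "invertible_ideal R P" if "P \<in> T" for P
    using that v w prime_factorization_invertible[OF v J] prime_factorization_invertible[OF w J]
    unfolding T_def is_prime_factorization_def by auto
  have fin: "finite T" using v w unfolding T_def is_prime_factorization_def by auto
  have prod: "prime_power_product R T u = J"
    if u: "is_prime_factorization R J u" and sub: "ideal_prime_support u \<subseteq> T" for u
  proof -
    have "prime_power_product R (ideal_prime_support u) u = prime_power_product R T u"
      using sub T(2) by (intro prime_power_product_mono_neutral[OF fin])
        (auto simp: ideal_prime_support_def intro: primeideal.axioms)
    then show ?thesis using u unfolding is_prime_factorization_def by metis
  qed
  have "prime_power_product R T w = prime_power_product R T v"
    using prod[OF v] prod[OF w] by (simp add: T_def)
  then have "w Q = v Q" if "Q \<in> T"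
    using prime_power_product_inj[OF fin, of w v Q] T that by auto
  then show "w Q = v Q" by (cases "Q \<in> T") (auto simp: T_def ideal_prime_support_def)
qed

text \<open>Common counting principle for both divisor functions. Only the values of the exponent
  function on \<open>S\<close> matter, so it may be restricted to \<open>S\<close>; on such
  functions the product is injective.\<close>

lemma card_prime_power_products:
  assumes "finite S" "\<And>P. P \<in> S \<Longrightarrow> primeideal P R" "\<And>P. P \<in> S \<Longrightarrow> invertible_ideal R P"
  shows "card {prime_power_product R S a | a. \<forall>P\<in>S. a P \<in> A P} = (\<Prod>P\<in>S. card (A P))"
proof -
  have "inj_on (prime_power_product R S) (PiE S A)"
    using prime_power_product_inj[OF assms] by (intro inj_onI PiE_ext) auto
  moreover have "{prime_power_product R S a | a. \<forall>P\<in>S. a P \<in> A P} = prime_power_product R S ` PiE S A"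
  proof safe
    fix a assume a: "\<forall>P\<in>S. a P \<in> A P"
    have "prime_power_product R S a = prime_power_product R S (restrict a S)"
      unfolding prime_power_product_def
      using assms primeideal.axioms(1) ideals_set_is_comm_monoid
      by (intro comm_monoid.finprod_cong') (auto intro!: ideals_pow_ideal)
    with a show "prime_power_product R S a \<in> prime_power_product R S ` PiE S A" by auto
  qed auto
  ultimately show ?thesis using assms by (simp add: card_image card_PiE)
qed

lemma ideal_tau_eq:
  assumes "invertible_ideal R J" and v: "is_prime_factorization R J v"
  shows "ideal_tau R J = (\<Prod>P\<in>ideal_prime_support v. v P + 1)"
proof -
  have "ideal_tau R J = (\<Prod>P\<in>ideal_prime_support v. card {..v P})"
    unfolding ideal_tau_def ideal_prime_divisors_def prime_exponent_eq[OF assms]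
    using card_prime_power_products[of "ideal_prime_support v" "\<lambda>P. {..v P}"]
      prime_factorization_invertible[OF v] assms v
    by (auto simp: is_prime_factorization_def)
  then show ?thesis by simp
qed

lemma ideal_tau_exponential_eq:
  assumes "invertible_ideal R J" and v: "is_prime_factorization R J v"
  shows "ideal_tau_exponential R J = (\<Prod>P\<in>ideal_prime_support v. card {b. b dvd v P})"
proof -
  have "ideal_tau_exponential R J = (\<Prod>P\<in>ideal_prime_support v. card {b. b > 0 \<and> b dvd v P})"
    unfolding ideal_tau_exponential_def ideal_prime_divisors_def prime_exponent_eq[OF assms]
    using card_prime_power_products[of "ideal_prime_support v" "\<lambda>P. {b. b > 0 \<and> b dvd v P}"]
      prime_factorization_invertible[OF v] assms v
    by (auto simp: is_prime_factorization_def)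
  \<comment> \<open>Exponents on the support are positive, and 0 divides no positive number.\<close>
  moreover have "{b. b > 0 \<and> b dvd v P} = {b. b dvd v P}" if "P \<in> ideal_prime_support v" for P
    using that by (auto simp: ideal_prime_support_def intro!: Nat.gr0I)
  ultimately show ?thesis by (simp cong: prod.cong)
qed

end

section \<open>The norm of a number field\<close>

text \<open>For a fraction in lowest terms with denominator \<open>t\<close>, every power of
  \<open>t\<close> divides the fixed nonzero \<open>c\<close>, so \<open>t\<close> is 1.\<close>

lemma Ints_if_bounded_denominators:
  fixes r :: rat and c :: int
  assumes "c \<noteq> 0" and "\<And>k. of_int c * r ^ k \<in> \<int>"
  shows "r \<in> \<int>"
proof -
  obtain s t where st: "quotient_of r = (s, t)" by (cases "quotient_of r")
  have r: "r = of_int s / of_int t" and t: "t > 0" and cop: "coprime s t"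
    using quotient_of_div[OF st] quotient_of_denom_pos[OF st] quotient_of_coprime[OF st] by auto
  have dvd: "t ^ k dvd c" for k
  proof -
    obtain m where "of_int c * r ^ k = of_int m" using assms(2) Ints_cases by blast
    then have "of_int (c * s ^ k) = (of_int (m * t ^ k) :: rat)"
      using t by (simp add: r power_divide field_simps)
    then have "c * s ^ k = m * t ^ k" unfolding of_int_eq_iff .
    then have "t ^ k dvd c * s ^ k" by simp
    moreover have "coprime (t ^ k) (s ^ k)" using cop by (simp add: coprime_commute)
    ultimately show ?thesis using coprime_dvd_mult_left_iff by blast
  qed
  have "t < 2"
  proof (rule ccontr)
    assume "\<not> t < 2"
    \<comment> \<open>The exponent is the absolute value of \<open>c\<close>, for which the power of
      2 already exceeds that absolute value.\<close>
    then have "2 ^ nat \<bar>c\<bar> \<le> t ^ nat \<bar>c\<bar>" by (intro power_mono) auto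
    also have "\<dots> \<le> \<bar>t ^ nat \<bar>c\<bar>\<bar>" by (rule abs_ge_self)
    also have "\<dots> \<le> \<bar>c\<bar>" by (rule dvd_imp_le_int[OF assms(1) dvd])
    finally have "int (2 ^ nat \<bar>c\<bar>) \<le> int (nat \<bar>c\<bar>)" by simp
    then show False using less_exp[of "nat \<bar>c\<bar>"] by linarith
  qed
  with t have "t = 1" by simp
  with r show ?thesis by simp
qed

text \<open>A numbered basis is bundled with its coordinate functionals so that multiplication by an
  element becomes a rational matrix. Linear independence is encoded by the duality
  \<open>c_b\<close>.\<close>

locale rat_basis =
  fixes n :: nat and b :: "nat \<Rightarrow> 'k::field_char_0" and c :: "nat \<Rightarrow> 'k \<Rightarrow> rat"
  assumes c_add: "c i (x + y) = c i x + c i y"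
    and c_scale: "c i (of_rat q * x) = q * c i x"
    and expand: "x = (\<Sum>i<n. of_rat (c i x) * b i)"
    and c_b: "i < n \<Longrightarrow> j < n \<Longrightarrow> c i (b j) = (if i = j then 1 else 0)"
begin

definition mult_mat :: "'k \<Rightarrow> rat mat" where
  "mult_mat x = mat n n (\<lambda>(i, j). c i (x * b j))"

definition field_norm :: "'k \<Rightarrow> rat" where "field_norm x = det (mult_mat x)"

lemma mult_mat_carrier [simp]: "mult_mat x \<in> carrier_mat n n" by (simp add: mult_mat_def)

lemma c_sum: "c i (\<Sum>j\<in>S. f j) = (\<Sum>j\<in>S. c i (f j))"
proof -
  have "c i 0 = 0" using c_scale[of i 0 0] by simp
  then show ?thesis by (induction S rule: infinite_finite_induct) (simp_all add: c_add)
qed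

lemma mult_mat_mult: "mult_mat (x * y) = mult_mat x * mult_mat y"
proof (rule eq_matI)
  fix i j assume "i < dim_row (mult_mat x * mult_mat y)" "j < dim_col (mult_mat x * mult_mat y)"
  then have ij: "i < n" "j < n" by (simp_all add: mult_mat_def)
  have "c i (x * y * b j) = c i (\<Sum>k<n. of_rat (c k (y * b j)) * (x * b k))"
    by (subst mult.assoc, subst expand[of "y * b j"]) (simp add: sum_distrib_left mult_ac)
  also have "\<dots> = (\<Sum>k<n. c k (y * b j) * c i (x * b k))" by (simp add: c_sum c_scale)
  finally show "mult_mat (x * y) $$ (i, j) = (mult_mat x * mult_mat y) $$ (i, j)"
    using ij by (simp add: mult_mat_def scalar_prod_def lessThan_atLeast0 mult.commute)
qed (simp_all add: mult_mat_def)

lemma field_norm_mult: "field_norm (x * y) = field_norm x * field_norm y"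
  unfolding field_norm_def mult_mat_mult by (rule det_mult[of _ n]) simp_all

lemma field_norm_of_rat: "field_norm (of_rat q) = q ^ n"
proof -
  have "mult_mat (of_rat q) = q \<cdot>\<^sub>m 1\<^sub>m n"
    by (rule eq_matI) (simp_all add: mult_mat_def c_scale c_b)
  then show ?thesis by (simp add: field_norm_def)
qed

lemma field_norm_power: "field_norm (x ^ k) = field_norm x ^ k"
  using field_norm_of_rat[of 1] by (induction k) (simp_all add: field_norm_mult)

section \<open>Integrality of the norm\<close>

lemma common_denominator:
  assumes "finite F"
  obtains d :: nat where "d > 0" "\<And>i x. i < n \<Longrightarrow> x \<in> F \<Longrightarrow> of_nat d * c i x \<in> \<int>"
proof -
  have "\<exists>d>0. \<forall>q\<in>A. of_nat d * q \<in> \<int>" if "finite A" for A :: "rat set"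
    using that
  proof induction
    case empty
    then show ?case by (auto intro: exI[of _ 1])
  next
    case (insert q A)
    then obtain d where d: "d > 0" "\<forall>q\<in>A. of_nat d * q \<in> \<int>" by auto
    obtain s t where st: "quotient_of q = (s, t)" by (cases "quotient_of q")
    have q: "q = of_int s / of_int t" and t: "t > 0"
      using quotient_of_div[OF st] quotient_of_denom_pos[OF st] by auto
    have "of_nat (nat t) * q = of_int s" using q t by simp
    then have "of_nat (d * nat t) * q = of_int (int d * s)" by simp
    then have "of_nat (d * nat t) * q \<in> \<int>" by (metis Ints_of_int)
    moreover have "of_nat (d * nat t) * q' \<in> \<int>" if "q' \<in> A" for q'
    proof -
      have "of_nat (nat t) * (of_nat d * q') \<in> \<int>" using d(2) that by (meson Ints_mult Ints_of_nat)
      then show ?thesis by (simp add: mult_ac)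
    qed
    ultimately show ?case using d t by (intro exI[of _ "d * nat t"]) auto
  qed
  from this[of "(\<lambda>(i, x). c i x) ` ({..<n} \<times> F)"] assms that show ?thesis by force
qed

text \<open>A monic equation of degree \<open>m\<close> expresses every power of \<open>a\<close>
  through the powers below \<open>m\<close> with integer coefficients. Hence a common denominator
  for those finitely many powers, multiplied by the basis elements, serves all powers.\<close>

lemma bounded_denominator_powers:
  assumes "algebraic_int a"
  obtains d :: nat where "d > 0" "\<And>i j k. i < n \<Longrightarrow> j < n \<Longrightarrow> of_nat d * c i (a ^ k * b j) \<in> \<int>"
proof -
  obtain p where p: "\<And>i. coeff p i \<in> \<int>" "lead_coeff p = 1" "poly p a = 0"
    using assms by (metis algebraic_int.cases)
  define m where "m = degree p"
  obtain d :: nat where d: "d > 0"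
    "\<And>i x. i < n \<Longrightarrow> x \<in> (\<lambda>(k, j). a ^ k * b j) ` ({..<m} \<times> {..<n}) \<Longrightarrow> of_nat d * c i x \<in> \<int>"
    using common_denominator[of "(\<lambda>(k, j). a ^ k * b j) ` ({..<m} \<times> {..<n})"] by blast
  have "of_nat d * c i (a ^ k * b j) \<in> \<int>" if ij: "i < n" "j < n" for i j k
  proof (induction k rule: less_induct)
    case (less k)
    show ?case
    proof (cases "k < m")
      case True
      then have "a ^ k * b j \<in> (\<lambda>(k, j). a ^ k * b j) ` ({..<m} \<times> {..<n})"
        using ij by (intro image_eqI[of _ _ "(k, j)"]) auto
      then show ?thesis by (rule d(2)[OF ij(1)])
    next
      case False
      have "(\<Sum>l<m. coeff p l * a ^ l) + a ^ m = 0"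
        using p(2,3) by (simp add: poly_altdef m_def lessThan_Suc_atMost[symmetric])
      then have "a ^ m = - (\<Sum>l<m. coeff p l * a ^ l)" by (simp add: eq_neg_iff_add_eq_0 add.commute)
      \<comment> \<open>All exponents \<open>k - m + l\<close> are below \<open>k\<close>, so the
        induction hypothesis applies to each term.\<close>
      then have "a ^ (k - m) * a ^ m * b j = (\<Sum>l<m. - coeff p l * (a ^ (k - m + l) * b j))"
        by (simp add: sum_distrib_left sum_distrib_right power_add mult_ac sum_negf)
      also have "a ^ (k - m) * a ^ m = a ^ k" using False by (simp flip: power_add)
      finally have eq: "a ^ k * b j = (\<Sum>l<m. - coeff p l * (a ^ (k - m + l) * b j))" .
      have "of_nat d * c i (- coeff p l * (a ^ (k - m + l) * b j)) \<in> \<int>" if "l < m" for l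
      proof -
        obtain z where z: "coeff p l = of_int z" using p(1) Ints_cases by blast
        then have neg: "- coeff p l = of_rat (of_int (- z))" by (simp add: of_rat_minus)
        have "of_nat d * c i (- coeff p l * (a ^ (k - m + l) * b j)) =
            of_int (- z) * (of_nat d * c i (a ^ (k - m + l) * b j))"
          unfolding neg mult.assoc c_scale by (rule mult.left_commute)
        also have "\<dots> \<in> \<int>" by (rule Ints_mult[OF Ints_of_int less]) (use that False in auto)
        finally show ?thesis .
      qed
      then show ?thesis unfolding eq c_sum sum_distrib_left by (intro Ints_sum) auto
    qed
  qed
  with d that show ?thesis by blast
qed

text \<open>The \<open>k\<close>-th power of the norm is the determinant of the matrix of
  \<open>a ^ k\<close>, whose entries have the common denominator \<open>d\<close> for all
  \<open>k\<close>. So \<open>d ^ n\<close> clears the denominators of all powers of the norm, which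
  must then be an integer.\<close>

lemma field_norm_algebraic_int:
  assumes "algebraic_int a"
  shows "field_norm a \<in> \<int>"
proof -
  obtain d :: nat where d: "d > 0" "\<And>i j k. i < n \<Longrightarrow> j < n \<Longrightarrow> of_nat d * c i (a ^ k * b j) \<in> \<int>"
    using bounded_denominator_powers[OF assms] by blast
  have "of_nat d ^ n * field_norm a ^ k \<in> \<int>" for k
  proof -
    have "of_nat d ^ n * field_norm a ^ k = of_nat d ^ n * det (mult_mat (a ^ k))"
      using field_norm_power[of a k] by (simp add: field_norm_def)
    also have "\<dots> = det (of_nat d \<cdot>\<^sub>m mult_mat (a ^ k))"
      unfolding det_smult by (simp add: mult_mat_def)
    also have "\<dots> \<in> \<int>"
    proof (subst det_def'[of _ n])
      have entry: "(of_nat d \<cdot>\<^sub>m mult_mat (a ^ k)) $$ (i, q i) \<in> \<int>" if "q permutes {0..<n}" "i < n" for q i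
        using d(2)[of i "q i" k] that permutes_in_image[OF that(1), of i] by (simp add: mult_mat_def)
      show "(\<Sum>q\<in>{q. q permutes {0..<n}}. signof q *
          (\<Prod>i = 0..<n. (of_nat d \<cdot>\<^sub>m mult_mat (a ^ k)) $$ (i, q i))) \<in> \<int>"
      proof (rule Ints_sum, rule Ints_mult)
        fix q assume "q \<in> {q. q permutes {0..<n}}"
        then have perm: "q permutes {0..<n}" by simp
        show "(\<Prod>i = 0..<n. (of_nat d \<cdot>\<^sub>m mult_mat (a ^ k)) $$ (i, q i)) \<in> \<int>"
          by (intro Ints_prod entry[OF perm]) auto
      qed (rule Ints_of_int)
    qed simp
    finally show ?thesis .
  qed
  then show ?thesis
    using Ints_if_bounded_denominators[of "int d ^ n" "field_norm a"] d(1) by simp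
qed

end

lemma rat_basis_exists:
  assumes "number_field TYPE('k::field_char_0)"
  shows "\<exists>b c. rat_basis (degree_over_rat TYPE('k)) (b :: nat \<Rightarrow> 'k) c"
proof -
  interpret Q: vector_space "rat_scale :: rat \<Rightarrow> 'k \<Rightarrow> 'k" by (rule vector_space_rat_scale)
  obtain B0 :: "'k set" where B0: "finite B0" "Q.span B0 = UNIV"
    using assms unfolding number_field_def by blast
  obtain B where B: "Q.independent B" "UNIV \<subseteq> Q.span B" "card B = Q.dim (UNIV :: 'k set)"
    using Q.basis_exists[of "UNIV :: 'k set"] by metis
  have fin: "finite B" using Q.independent_span_bound[OF B0(1) B(1)] B0 by auto
  define n where "n = degree_over_rat TYPE('k)"
  have "card B = n" using B(3) by (simp add: n_def degree_over_rat_def)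
  then obtain b where b: "bij_betw b {..<n} B"
    using ex_bij_betw_nat_finite[OF fin] by (auto simp: lessThan_atLeast0)
  have "rat_basis n b (\<lambda>i x. Q.representation B x (b i))"
  proof
    fix i x y show "Q.representation B (x + y) (b i) = Q.representation B x (b i) + Q.representation B y (b i)"
      using B by (subst Q.representation_add) auto
  next
    fix i q x show "Q.representation B (of_rat q * x) (b i) = q * Q.representation B x (b i)"
      using B(1) Q.representation_scale[OF B(1), of x q] B(2) by (simp add: rat_scale_def subset_iff)
  next
    fix x
    have "x = (\<Sum>v\<in>B. rat_scale (Q.representation B x v) v)"
      using B fin by (subst Q.sum_representation_eq) auto
    also have "\<dots> = (\<Sum>i<n. rat_scale (Q.representation B x (b i)) (b i))"
      by (rule sum.reindex_bij_betw[OF b, symmetric])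
    also have "\<dots> = (\<Sum>i<n. of_rat (Q.representation B x (b i)) * b i)"
      by (simp add: rat_scale_def)
    finally show "x = (\<Sum>i<n. of_rat (Q.representation B x (b i)) * b i)" .
  next
    fix i j assume "i < n" "j < n"
    then show "Q.representation B (b j) (b i) = (if i = j then 1 else 0)"
      using b B Q.representation_basis[of B "b j"] by (auto simp: bij_betw_def inj_on_def)
  qed
  then show ?thesis unfolding n_def by blast
qed

section \<open>Squares of ideals in the ring of integers\<close>

context "domain"
begin

text \<open>Otherwise cancelling \<open>I\<close> would put the whole ring inside
  \<open>Q\<close>.\<close>

lemma invertible_ideal_mult_prime_psubset:
  assumes I: "invertible_ideal R I" and Q: "primeideal Q R"
  obtains x where "x \<in> I" "x \<notin> I \<cdot> Q"
proof -
  have iI: "ideal I R" using I unfolding invertible_ideal_def by simp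
  have iQ: "ideal Q R" using Q by (rule primeideal.axioms)
  have "\<not> I \<subseteq> I \<cdot> Q"
  proof
    assume "I \<subseteq> I \<cdot> Q"
    then have "I \<cdot> carrier R \<subseteq> I \<cdot> Q" unfolding ideal_prod_one[OF iI] .
    from invertible_ideal_cancel_subset[OF I oneideal iQ this] show False
      using primeideal.I_notcarr[OF Q] ideal.Icarr[OF iQ] by blast
  qed
  with that show ?thesis by blast
qed

text \<open>With \<open>x\<close> in \<open>I\<close> outside both \<open>I \<cdot> Q1\<close> and
  \<open>I \<cdot> Q2\<close>, the principal ideal of \<open>x\<close> is \<open>I \<cdot> Y\<close>
  with \<open>Y\<close> inside neither prime. Since \<open>x\<close> squared is \<open>a\<close>
  times \<open>y\<close>, the ideal of \<open>y\<close> is the square of \<open>Y\<close>, so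
  neither prime contains \<open>y\<close>.\<close>

lemma ideal_square_root_element:
  assumes I: "ideal I R" and a: "a \<in> carrier R" "a \<noteq> \<zero>" and sq: "I \<cdot> I = PIdl a"
    and Q1: "primeideal Q1 R" and Q2: "primeideal Q2 R"
  obtains x y where "x \<in> carrier R" "y \<in> carrier R" "x \<otimes> x = a \<otimes> y" "y \<notin> Q1" "y \<notin> Q2"
proof -
  have inv: "invertible_ideal R I" by (rule invertible_ideal_factors(1)[OF I I a sq])
  have iQ1: "ideal Q1 R" and iQ2: "ideal Q2 R" using Q1 Q2 by (auto intro: primeideal.axioms)
  interpret I: ideal I R by fact
  interpret J1: ideal "I \<cdot> Q1" R by (rule ideal_prod_is_ideal[OF I iQ1])
  interpret J2: ideal "I \<cdot> Q2" R by (rule ideal_prod_is_ideal[OF I iQ2])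
  obtain x where x: "x \<in> I" "x \<notin> I \<cdot> Q1" "x \<notin> I \<cdot> Q2"
  proof -
    obtain u where u: "u \<in> I" "u \<notin> I \<cdot> Q1" using invertible_ideal_mult_prime_psubset[OF inv Q1] .
    obtain v where v: "v \<in> I" "v \<notin> I \<cdot> Q2" using invertible_ideal_mult_prime_psubset[OF inv Q2] .
    have uv: "u \<in> carrier R" "v \<in> carrier R" using u v by auto
    show ?thesis
    \<comment> \<open>Avoidance of two ideals: if each of \<open>u\<close> and \<open>v\<close>
      avoids only one of them, their sum avoids both; otherwise one of the two elements already
      does.\<close>
    proof (cases "u \<in> I \<cdot> Q2 \<and> v \<in> I \<cdot> Q1")
      case True
      have "u \<oplus> v \<notin> I \<cdot> Q1"
      proof
        assume "u \<oplus> v \<in> I \<cdot> Q1"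
        then have "(u \<oplus> v) \<ominus> v \<in> I \<cdot> Q1" using True by (simp add: J1.a_closed minus_eq)
        moreover have "(u \<oplus> v) \<ominus> v = u" using uv by (simp add: minus_eq a_assoc r_neg)
        ultimately show False using u by simp
      qed
      moreover have "u \<oplus> v \<notin> I \<cdot> Q2"
      proof
        assume "u \<oplus> v \<in> I \<cdot> Q2"
        then have "(u \<oplus> v) \<ominus> u \<in> I \<cdot> Q2" using True by (simp add: J2.a_closed minus_eq)
        moreover have "(u \<oplus> v) \<ominus> u = v" using uv by (simp add: minus_eq a_comm[of u v] a_assoc r_neg)
        ultimately show False using v by simp
      qed
      ultimately show ?thesis using that[of "u \<oplus> v"] u v by simp
    next
      case False
      then show ?thesis using that u v by blast
    qed
  qed
  have xR: "x \<in> carrier R" using x by simp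
  have "x \<otimes> x \<in> PIdl a" unfolding sq[symmetric] using x by (auto intro: ideal_prod.prod)
  then obtain y where y: "y \<in> carrier R" "x \<otimes> x = a \<otimes> y"
    using a by (auto simp: cgenideal_def m_comm)
  have X: "ideal (PIdl x) R" by (rule cgenideal_ideal[OF xR])
  obtain Y where Y: "ideal Y R" "PIdl x = I \<cdot> Y"
    using invertible_ideal_divides[OF inv X cgenideal_minimal[OF I x(1)]] .
  have "y \<notin> Q" if Q: "primeideal Q R" and xQ: "x \<notin> I \<cdot> Q" for Q
  proof
    assume yQ: "y \<in> Q"
    have iQ: "ideal Q R" using Q by (rule primeideal.axioms)
    \<comment> \<open>Both sides are the square of \<open>I \<cdot> Y\<close>. If \<open>y\<close>
      were in \<open>Q\<close>, the right side would lie in \<open>a\<close> times \<open>Q\<close>,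
      and cancelling \<open>a\<close> would give \<open>Y \<cdot> Y\<close> inside
      \<open>Q\<close>.\<close>
    have "(PIdl a) \<cdot> (Y \<cdot> Y) = (PIdl x) \<cdot> (PIdl x)"
    proof -
      have "(PIdl x) \<cdot> (PIdl x) = I \<cdot> (Y \<cdot> (I \<cdot> Y))"
        unfolding Y(2) by (rule ideal_prod_assoc[OF I Y(1) ideal_prod_is_ideal[OF I Y(1)]])
      also have "Y \<cdot> (I \<cdot> Y) = I \<cdot> (Y \<cdot> Y)"
        by (simp only: ideal_prod_assoc[OF Y(1) I Y(1), symmetric] ideal_prod_commute[OF Y(1) I]
            ideal_prod_assoc[OF I Y(1) Y(1)])
      also have "I \<cdot> (I \<cdot> (Y \<cdot> Y)) = (PIdl a) \<cdot> (Y \<cdot> Y)"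
        unfolding sq[symmetric] by (rule ideal_prod_assoc[OF I I ideal_prod_is_ideal[OF Y(1) Y(1)], symmetric])
      finally show ?thesis by (rule sym)
    qed
    also have "\<dots> \<subseteq> (PIdl a) \<cdot> Q"
    proof
      fix z assume "z \<in> (PIdl x) \<cdot> (PIdl x)"
      then obtain r where r: "r \<in> carrier R" "z = x \<otimes> (r \<otimes> x)"
        unfolding cgenideal_mult_mem[OF xR X] by (auto simp: cgenideal_def)
      then have "z = r \<otimes> (x \<otimes> x)" using xR by (simp add: m_lcomm)
      also have "\<dots> = a \<otimes> (r \<otimes> y)" unfolding y(2) using r a y by (simp add: m_lcomm)
      finally show "z \<in> (PIdl a) \<cdot> Q"
        unfolding cgenideal_mult_mem[OF a(1) iQ] using ideal.I_l_closed[OF iQ yQ r(1)] by blast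
    qed
    finally have "Y \<cdot> Y \<subseteq> Q"
      by (rule cgenideal_cancel_subset[OF a ideal_prod_is_ideal[OF Y(1) Y(1)] iQ])
    then have "Y \<subseteq> Q" using primeideal_divides_ideal_prod[OF Q Y(1) Y(1)] by blast
    then have "PIdl x \<subseteq> I \<cdot> Q" unfolding Y(2) by (rule ideal_prod_mono[OF subset_refl])
    then show False using cgenideal_self[OF xR] xQ by blast
  qed
  then show ?thesis using that xR y Q1 Q2 x by blast
qed

end

section \<open>Algebraic integers outside the primes above p\<close>

lemma ring_of_integers_simps [simp]:
  "carrier ring_of_integers = {x. algebraic_int x}"
  "monoid.mult ring_of_integers = (*)" "monoid.one ring_of_integers = 1"
  "ring.add ring_of_integers = (+)" "ring.zero ring_of_integers = 0"
  by (simp_all add: ring_of_integers_def ring_of_type_algebra_def fun_eq_iff)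

lemma domain_ring_of_integers:
  assumes "cring (ring_of_integers :: 'k::field_char_0 ring)"
  shows "domain (ring_of_integers :: 'k ring)"
  using assms unfolding domain_def domain_axioms_def by auto

text \<open>That the algebraic integers form a ring is part of the hypothesis \<open>primeideal\<close>
  of the theorem, so it is assumed here instead of being proved.\<close>

context
  assumes cring: "cring (ring_of_integers :: 'k::field_char_0 ring)"
begin

interpretation O: cring "ring_of_integers :: 'k ring" by (rule cring)

lemma algebraic_int_add: "algebraic_int (x :: 'k) \<Longrightarrow> algebraic_int y \<Longrightarrow> algebraic_int (x + y)"
  using O.a_closed[of x y] by simp

lemma algebraic_int_mult: "algebraic_int (x :: 'k) \<Longrightarrow> algebraic_int y \<Longrightarrow> algebraic_int (x * y)"
  using O.m_closed[of x y] by simp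

lemma algebraic_int_sum: "(\<And>i. i \<in> S \<Longrightarrow> algebraic_int (f i :: 'k)) \<Longrightarrow> algebraic_int (\<Sum>i\<in>S. f i)"
  by (induction S rule: infinite_finite_induct) (auto intro: algebraic_int_add)

lemma algebraic_int_of_int: "algebraic_int (of_int z :: 'k)"
  by (auto intro: int_imp_algebraic_int)

lemma algebraic_int_ipoly: "algebraic_int (x :: 'k) \<Longrightarrow> algebraic_int (poly (map_poly of_int f) x)"
  by (induction f) (auto simp: map_poly_pCons intro: algebraic_int_add algebraic_int_mult algebraic_int_of_int)

text \<open>The constant term of a polynomial that vanishes at \<open>y\<close> modulo the primes may be divisible by
  \<open>p\<close>; since \<open>y\<close> avoids the primes, one can then divide by \<open>y\<close>.\<close>

lemma unit_constant_term:
  fixes y :: 'k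
  assumes Q: "\<And>Q. Q \<in> \<Q> \<Longrightarrow> primeideal Q ring_of_integers"
    and p: "\<And>Q. Q \<in> \<Q> \<Longrightarrow> of_int p \<in> Q" and y: "algebraic_int y" "\<And>Q. Q \<in> \<Q> \<Longrightarrow> y \<notin> Q"
    and f: "\<not> p dvd lead_coeff f" "\<And>Q. Q \<in> \<Q> \<Longrightarrow> poly (map_poly of_int f) y \<in> Q"
  shows "\<exists>c h. \<not> p dvd c \<and> algebraic_int h \<and> (\<forall>Q\<in>\<Q>. of_int c + y * h \<in> Q)"
  using f
proof (induction f)
  case 0
  then show ?case by simp
next
  case (pCons c f)
  let ?h = "poly (map_poly of_int f) y"
  have h: "algebraic_int ?h" by (rule algebraic_int_ipoly[OF y(1)])
  have mem: "of_int c + y * ?h \<in> Q" if "Q \<in> \<Q>" for Q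
    using pCons.prems(2)[OF that] by (simp add: map_poly_pCons)
  show ?case
  proof (cases "p dvd c")
    case True
    then obtain r where r: "c = p * r" ..
    \<comment> \<open>Otherwise the leading coefficient would be \<open>c\<close>, which
      \<open>p\<close> divides. Dropping \<open>c\<close> therefore keeps the leading
      coefficient.\<close>
    have "f \<noteq> 0" using True pCons.prems(1) by auto
    moreover have "?h \<in> Q" if "Q \<in> \<Q>" for Q
    proof -
      interpret Q: primeideal Q "ring_of_integers :: 'k ring" by (rule Q[OF that])
      have "of_int (- r) * of_int p \<in> Q"
        using Q.I_l_closed[OF p[OF that], of "of_int (- r)"] algebraic_int_of_int[of "- r"] by simp
      then have "of_int c + y * ?h + of_int (- r) * of_int p \<in> Q"
        using Q.a_closed[OF mem[OF that]] unfolding ring_of_integers_simps by blast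
      then have "y * ?h \<in> Q" by (simp add: r)
      then show ?thesis using Q.I_prime[of y ?h] y that h by auto
    qed
    ultimately show ?thesis using pCons.IH pCons.prems(1) by simp
  next
    case False
    then show ?thesis using h mem by blast
  qed
qed

text \<open>A monic equation for \<open>w\<close>, with \<open>c\<close> substituted for \<open>p * w\<close>, produces a multiple of \<open>y\<close>.\<close>

lemma dvd_int_if_unit_mod_prime:
  fixes y h w :: 'k
  assumes p: "prime p" and c: "\<not> p dvd c" and y: "y \<noteq> 0" "algebraic_int y"
    and h: "algebraic_int h" and w: "algebraic_int w" and eq: "y * h = of_int p * w - of_int c"
  shows "\<exists>m k. \<not> p dvd m \<and> algebraic_int k \<and> y * k = of_int m"
proof -
  obtain g where g: "poly (map_poly of_int g) w = 0" "lead_coeff g = 1"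
    using w unfolding algebraic_int_altdef_ipoly by blast
  define d where "d = degree g"
  \<comment> \<open>\<open>T i\<close> is integral since \<open>p * w\<close> and \<open>c\<close>
    differ by the multiple \<open>y * h\<close> of \<open>y\<close>, so their \<open>i\<close>-th
    powers also differ by a multiple of \<open>y\<close>.\<close>
  define T where "T i = ((of_int p * w) ^ i - of_int c ^ i) / y" for i
  have T: "algebraic_int (T i)" for i
  proof (induction i)
    case 0
    then show ?case by (simp add: T_def)
  next
    case (Suc i)
    have "of_int p * w = of_int c + y * h" using eq by simp
    then have "T (Suc i) = of_int p * w * T i + of_int (c ^ i) * h"
      using y by (simp add: T_def field_simps)
    then show ?case using Suc h w
      by (auto intro!: algebraic_int_add algebraic_int_mult intro: algebraic_int_of_int
          simp del: of_int_power)
  qed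
  \<comment> \<open>\<open>m\<close> is \<open>p ^ d\<close> times the value of \<open>g\<close> at
    \<open>c / p\<close>. The same expression at \<open>w\<close> vanishes, and replacing
    \<open>p * w\<close> by \<open>c\<close> changes it by \<open>y * k\<close>.\<close>
  define m where "m = (\<Sum>i\<le>d. coeff g i * p ^ (d - i) * c ^ i)"
  define k where "k = - (\<Sum>i\<le>d. of_int (coeff g i * p ^ (d - i)) * T i)"
  have "(\<Sum>i\<le>d. of_int (coeff g i * p ^ (d - i)) * (of_int p * w) ^ i) = of_int p ^ d * poly (map_poly of_int g) w"
    unfolding poly_altdef sum_distrib_left
  proof (rule sum.cong)
    show "{..d} = {..degree (map_poly of_int g :: 'k poly)}" by (simp add: d_def degree_map_poly)
    fix i assume "i \<in> {..degree (map_poly of_int g :: 'k poly)}"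
    then have "i \<le> d" by (simp add: d_def degree_map_poly)
    then have "(of_int p :: 'k) ^ d = of_int p ^ (d - i) * of_int p ^ i" by (simp flip: power_add)
    then show "of_int (coeff g i * p ^ (d - i)) * (of_int p * w) ^ i =
        of_int p ^ d * (coeff (map_poly of_int g) i * w ^ i)"
      by (simp add: coeff_map_poly power_mult_distrib)
  qed
  then have zero: "(\<Sum>i\<le>d. of_int (coeff g i * p ^ (d - i)) * (of_int p * w) ^ i) = (0 :: 'k)"
    using g by simp
  have "(of_int p * w) ^ i = of_int c ^ i + y * T i" for i
    using y by (simp add: T_def)
  then have "of_int m + y * (- k) = (0 :: 'k)"
    using zero by (simp add: m_def k_def sum_distrib_left sum.distrib algebra_simps)
  then have "y * k = of_int m" by simp
  moreover have "algebraic_int k"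
    unfolding k_def by (auto intro!: algebraic_int_sum algebraic_int_mult algebraic_int_of_int T simp del: of_int_mult of_int_power)
  moreover have "\<not> p dvd m"
  proof
    assume "p dvd m"
    \<comment> \<open>Every term below the leading one contains a factor \<open>p\<close>, so
      \<open>m\<close> is congruent to \<open>c ^ d\<close> modulo \<open>p\<close>.\<close>
    have "m = (\<Sum>i<d. coeff g i * p ^ (d - i) * c ^ i) + c ^ d"
      unfolding m_def using g(2) by (simp add: d_def flip: lessThan_Suc_atMost)
    moreover have "p dvd (\<Sum>i<d. coeff g i * p ^ (d - i) * c ^ i)"
      by (intro dvd_sum) (auto intro!: dvd_mult dvd_mult2 dvd_power)
    ultimately have "p dvd c ^ d" using \<open>p dvd m\<close> by (metis dvd_add_right_iff)
    with p c show False using prime_dvd_power by blast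
  qed
  ultimately show ?thesis by blast
qed

end

section \<open>Parity of the degree\<close>

lemma even_exponent_if_square:
  fixes x y p :: int
  assumes "prime p" "x ^ 2 = p ^ n * y" "\<not> p dvd y"
  shows "even n"
proof -
  have "y \<noteq> 0" using assms(3) by auto
  with assms(1,2) have "x \<noteq> 0" by (auto simp: prime_gt_0_int)
  have "2 * multiplicity p x = multiplicity p (x ^ 2)"
    using prime_imp_prime_elem[OF assms(1)] \<open>x \<noteq> 0\<close>
    by (rule prime_elem_multiplicity_power_distrib[symmetric])
  also have "\<dots> = n"
    unfolding assms(2) using assms \<open>y \<noteq> 0\<close>
    by (subst prime_elem_multiplicity_mult_distrib)
      (auto simp: not_dvd_imp_multiplicity_0 prime_elem_multiplicity_power_distrib)
  finally show ?thesis by presburger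
qed

text \<open>The inclusions are stated so as to cover both a single prime, with \<open>I\<close>,
  \<open>Q1\<close> and \<open>Q2\<close> all equal, and a product of two distinct primes.\<close>

lemma even_degree_if_prime_is_square:
  fixes I Q1 Q2 :: "'k::field_char_0 set"
  assumes nf: "number_field TYPE('k)" and p: "prime p"
    and I: "ideal I ring_of_integers"
    and sq: "ideal_prod ring_of_integers I I = PIdl\<^bsub>ring_of_integers\<^esub> (of_nat p)"
    and Q1: "primeideal Q1 ring_of_integers" and Q2: "primeideal Q2 ring_of_integers"
    and IQ: "I \<subseteq> Q1" "I \<subseteq> Q2" and QI: "ideal_prod ring_of_integers Q1 Q2 \<subseteq> I"
  shows "even (degree_over_rat TYPE('k))"
proof -
  define n where "n = degree_over_rat TYPE('k)"
  define q where "q = int p"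
  have q: "prime q" "of_int q = (of_nat p :: 'k)" using p by (simp_all add: q_def)
  have cr: "cring (ring_of_integers :: 'k ring)" using Q1 by (rule primeideal.axioms)
  interpret O: "domain" "ring_of_integers :: 'k ring" by (rule domain_ring_of_integers[OF cr])
  note closed = algebraic_int_add[OF cr] algebraic_int_mult[OF cr] algebraic_int_of_int[OF cr]
  have pO: "of_nat p \<in> carrier (ring_of_integers :: 'k ring)" "of_nat p \<noteq> \<zero>\<^bsub>ring_of_integers :: 'k ring\<^esub>"
    using p closed(3)[of "int p"] by auto
  obtain x y :: 'k where x: "algebraic_int x" and y: "algebraic_int y" "y \<notin> Q1" "y \<notin> Q2"
    and xy: "x * x = of_int q * y"
    using O.ideal_square_root_element[OF I pO sq Q1 Q2] unfolding ring_of_integers_simps q mem_Collect_eq .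
  have "of_int q \<in> I"
    using O.cgenideal_self[OF pO(1)] O.ideal_prod_inter[OF I I] unfolding sq q by blast
  then have pQ: "of_int q \<in> Q" if "Q \<in> {Q1, Q2}" for Q using IQ that by auto
  have Qid: "0 \<in> Q" if "Q \<in> {Q1, Q2}" for Q
    using that Q1 Q2 additive_subgroup.zero_closed[of Q "ring_of_integers :: 'k ring"]
    by (auto dest!: primeideal.axioms(1) ideal.axioms(1))
  obtain f where f: "poly (map_poly of_int f) y = 0" "lead_coeff f = 1"
    using y(1) unfolding algebraic_int_altdef_ipoly by blast
  have "\<exists>c h. \<not> q dvd c \<and> algebraic_int h \<and> (\<forall>Q\<in>{Q1, Q2}. of_int c + y * h \<in> Q)"
  proof (rule unit_constant_term[OF cr _ pQ y(1)])
    show "\<not> q dvd lead_coeff f" unfolding f(2) using q(1) not_prime_unit by blast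
  qed (use Q1 Q2 y f Qid in auto)
  then obtain c h where c: "\<not> q dvd c" and h: "algebraic_int h"
    and ch: "\<And>Q. Q \<in> {Q1, Q2} \<Longrightarrow> of_int c + y * h \<in> Q" by blast
  define s where "s = of_int c + y * h"
  have s: "algebraic_int s" unfolding s_def by (intro closed y h)
  \<comment> \<open>\<open>s\<close> lies in both primes, so its square lies in \<open>I\<close> and
    its fourth power in the square of \<open>I\<close>, which is generated by
    \<open>p\<close>.\<close>
  have "s * s \<in> I" using QI ideal_prod.prod[of s Q1 s Q2 ring_of_integers] ch unfolding s_def by auto
  then have "s * s * (s * s) \<in> PIdl\<^bsub>ring_of_integers\<^esub> (of_nat p)"
    unfolding sq[symmetric] using ideal_prod.prod[of "s * s" I "s * s" I ring_of_integers] by simp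
  then obtain w where w: "algebraic_int w" "s * s * (s * s) = w * of_int q"
    unfolding q by (auto simp: cgenideal_def)
  \<comment> \<open>The difference of the fourth powers of \<open>s\<close> and \<open>c\<close> is
    divisible by \<open>s - c\<close>, which is \<open>y * h\<close>.\<close>
  have "y * (h * ((s + of_int c) * (s * s + of_int (c * c)))) = of_int q * w - of_int (c ^ 4)"
  proof -
    have "y * h = s - of_int c" by (simp add: s_def)
    then have "y * (h * ((s + of_int c) * (s * s + of_int (c * c)))) =
        (s - of_int c) * ((s + of_int c) * (s * s + of_int (c * c)))" by (simp only: mult.assoc[symmetric])
    also have "\<dots> = s * s * (s * s) - of_int (c ^ 4)" by (simp add: algebra_simps power4_eq_xxxx)
    finally show ?thesis using w by (simp add: mult.commute)
  qed
  moreover have "\<not> q dvd c ^ 4" using c q(1) prime_dvd_power by blast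
  moreover have "y \<noteq> 0" using y Qid by auto
  moreover have "algebraic_int (h * ((s + of_int c) * (s * s + of_int (c * c))))"
    by (intro closed h s)
  ultimately obtain m k where m: "\<not> q dvd m" and k: "algebraic_int k" "y * k = of_int m"
    using dvd_int_if_unit_mod_prime[OF cr q(1), of "c ^ 4" y _ w] y w by blast
  obtain b and c' :: "nat \<Rightarrow> 'k \<Rightarrow> rat" where "rat_basis n b c'"
    using rat_basis_exists[OF nf] unfolding n_def by blast
  then interpret rat_basis n b c' .
  obtain nx ny nk where nx: "field_norm x = of_int nx" and ny: "field_norm y = of_int ny" and nk: "field_norm k = of_int nk"
    using field_norm_algebraic_int x y k by (metis Ints_cases)
  \<comment> \<open>Taking norms of \<open>x * x = q * y\<close>, the rational number
    \<open>q\<close> contributes \<open>q ^ n\<close>.\<close>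
  have "field_norm (x * x) = field_norm (of_rat (of_int q) * y)" unfolding xy by simp
  then have "of_int (nx ^ 2) = (of_int (q ^ n * ny) :: rat)"
    unfolding field_norm_mult field_norm_of_rat nx ny by (simp add: power2_eq_square)
  then have "nx ^ 2 = q ^ n * ny" unfolding of_int_eq_iff .
  moreover have "\<not> q dvd ny"
  proof
    assume "q dvd ny"
    have "field_norm (y * k) = field_norm (of_rat (of_int m))" unfolding k(2) by simp
    then have "of_int (ny * nk) = (of_int (m ^ n) :: rat)"
      unfolding field_norm_mult field_norm_of_rat ny nk by simp
    then have "ny * nk = m ^ n" unfolding of_int_eq_iff .
    with \<open>q dvd ny\<close> have "q dvd m ^ n" by (metis dvd_mult2)
    with m q(1) show False using prime_dvd_power by blast
  qed
  ultimately show ?thesis unfolding n_def[symmetric] by (rule even_exponent_if_square[OF q(1)])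
qed

section \<open>The inequality\<close>

lemma card_divisors_less:
  assumes "e \<ge> (3::nat)"
  shows "card {d. d dvd e} < e"
proof -
  have "\<not> e - 1 dvd e"
  proof
    assume "e - 1 dvd e"
    then have "e - 1 dvd e - (e - 1)" by (rule dvd_diff_nat) simp
    moreover have "e - (e - 1) = 1" using assms by simp
    ultimately have "e - 1 dvd 1" by (simp only:)
    with assms show False by auto
  qed
  then have "{d. d dvd e} \<subseteq> {1..e} - {e - 1}"
    using dvd_imp_le[of _ e] dvd_pos_nat[of e] assms by (auto simp: Suc_le_eq)
  then have "card {d. d dvd e} \<le> card ({1..e} - {e - 1})" by (intro card_mono) auto
  with assms show ?thesis by auto
qed

lemma ratio_inequality:
  fixes e g :: nat
  assumes "e > 1" "g > 0" and small: "e = 2 \<Longrightarrow> g \<ge> 3"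
  shows "real (card {d. d dvd e} ^ g) / real ((e + 1) ^ g) + 1 / real g * (real g / (real e + 1))
    \<le> real e / (real e + 1)"
proof -
  \<comment> \<open>\<open>r\<close> is the contribution of one prime to the quotient of the divisor
    functions. The second summand of the claim is \<open>1 / (e + 1)\<close>, which leaves the bound
    below for \<open>r ^ g\<close>.\<close>
  define r where "r = real (card {d. d dvd e}) / (real e + 1)"
  have "r ^ g \<le> (real e - 1) / (real e + 1)"
  proof (cases "e = 2")
    case True
    have "{d. d dvd (2::nat)} = {1, 2}"
      using two_is_prime_nat by (auto simp: prime_nat_iff)
    then have r: "r = 2 / 3" by (simp add: r_def True)
    \<comment> \<open>The cube of 2/3 is 8/27, below the required 1/3, whereas its square 4/9 is too
      large.\<close>
    have "r ^ g \<le> r ^ 3" using small[OF True] by (intro power_decreasing) (simp_all add: r)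
    then show ?thesis by (simp add: r True power3_eq_cube)
  next
    case False
    with \<open>e > 1\<close> have "real (card {d. d dvd e}) \<le> real e - 1"
      using card_divisors_less[of e] by linarith
    then have le: "r \<le> (real e - 1) / (real e + 1)" by (simp add: r_def divide_right_mono)
    also have "\<dots> \<le> 1" by simp
    finally have "r ^ g \<le> r ^ 1" using \<open>g > 0\<close> by (intro power_decreasing) (simp_all add: r_def)
    with le show ?thesis by simp
  qed
  moreover have "real (card {d. d dvd e} ^ g) / real ((e + 1) ^ g) = r ^ g"
    by (simp add: r_def power_divide add.commute)
  moreover have "1 / real g * (real g / (real e + 1)) = 1 / (real e + 1)" using \<open>g > 0\<close> by simp
  moreover have "(real e - 1) / (real e + 1) + 1 / (real e + 1) = real e / (real e + 1)"
    by (simp flip: add_divide_distrib)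
  ultimately show ?thesis by linarith
qed

theorem theorem2p13:
  fixes n p g e :: nat
    and P :: "nat \<Rightarrow> 'k::field_char_0 set"
    and J :: "'k set"
  assumes "number_field TYPE('k)"
    and "n = degree_over_rat TYPE('k)"
    and "odd n" and "n \<ge> 3"
    and "galois_over_rat TYPE('k)"
    and "prime p"
    and "J = PIdl\<^bsub>ring_of_integers\<^esub> (of_nat p :: 'k)"
    and "g > 0" and "e > 0"
    and "\<And>i. i \<in> {1..g} \<Longrightarrow> primeideal (P i) ring_of_integers"
    and "inj_on P {1..g}"
    and "J = (\<Otimes>\<^bsub>ideals_set ring_of_integers\<^esub> i\<in>{1..g}. P i [^]\<^bsub>ideals_set ring_of_integers\<^esub> e)"
    and "e > 1"
  shows "real e / (real e + 1) \<ge>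
           real (ideal_tau_exponential ring_of_integers J) / real (ideal_tau ring_of_integers J)
           + 1 / real (ideal_omega ring_of_integers J) * (real g / (real e + 1))"
proof -
  let ?O = "ring_of_integers :: 'k ring"
  note prime = assms(10)
  have one: "1 \<in> {1..g}" and gg: "g \<in> {1..g}" using \<open>g > 0\<close> by auto
  have "cring ?O" using prime[OF one] by (rule primeideal.axioms)
  then interpret O: "domain" ?O by (rule domain_ring_of_integers)
  interpret M: comm_monoid "ideals_set ?O" by (rule O.ideals_set_is_comm_monoid)
  have ideal: "ideal (P i) ?O" if "i \<in> {1..g}" for i using prime[OF that] by (rule primeideal.axioms)
  have p: "of_nat p \<in> carrier ?O" "of_nat p \<noteq> \<zero>\<^bsub>?O\<^esub>"
    using \<open>prime p\<close> by (auto intro: int_imp_algebraic_int)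
  have J: "invertible_ideal ?O J"
    unfolding assms(7) by (rule O.invertible_ideal_cgenideal[OF p])
  have pJ: "of_nat p \<in> J" unfolding assms(7) by (rule O.cgenideal_self[OF p(1)])

  \<comment> \<open>Extension by zero makes the support exactly the given set of primes.\<close>
  define v where "v Q = (if Q \<in> P ` {1..g} then e else 0)" for Q
  have supp: "ideal_prime_support v = P ` {1..g}"
    using \<open>e > 0\<close> by (auto simp: ideal_prime_support_def v_def)
  have "J = prime_power_product ?O (P ` {1..g}) v"
  proof -
    have "prime_power_product ?O (P ` {1..g}) v = (\<Otimes>\<^bsub>ideals_set ?O\<^esub> i\<in>{1..g}. P i [^]\<^bsub>ideals_set ?O\<^esub> v (P i))"
      unfolding prime_power_product_def
      using assms(11) ideal by (intro M.finprod_reindex) (auto intro!: O.ideals_pow_ideal)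
    also have "\<dots> = J"
      unfolding assms(12) using ideal
      by (intro M.finprod_cong') (auto intro!: O.ideals_pow_ideal simp: v_def)
    finally show ?thesis by (rule sym)
  qed
  \<comment> \<open>Each \<open>P i\<close> contains \<open>J\<close>, hence the nonzero element
    \<open>p\<close>.\<close>
  moreover have "P i \<noteq> {\<zero>\<^bsub>?O\<^esub>}" if i: "i \<in> {1..g}" for i
  proof
    assume zero: "P i = {\<zero>\<^bsub>?O\<^esub>}"
    have "J \<subseteq> P i [^]\<^bsub>ideals_set ?O\<^esub> e"
      unfolding assms(12) using i ideal by (intro O.ideals_finprod_subset) (auto intro: O.ideals_pow_ideal)
    also have "\<dots> = ideal_prod ?O (P i [^]\<^bsub>ideals_set ?O\<^esub> (e - 1)) (P i)"
      using \<open>e > 0\<close> by (cases e) simp_all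
    also have "\<dots> \<subseteq> P i"
      using O.ideal_prod_inter[OF O.ideals_pow_ideal[OF ideal[OF i]] ideal[OF i]] by blast
    finally show False using pJ p(2) zero by auto
  qed
  ultimately have v: "is_prime_factorization ?O J v"
    unfolding is_prime_factorization_def supp using prime by auto
  have card: "card (P ` {1..g}) = g" using assms(11) by (simp add: card_image)
  have tau: "ideal_tau ?O J = (e + 1) ^ g"
    unfolding O.ideal_tau_eq[OF J v] supp using card by (simp add: v_def)
  have tau_e: "ideal_tau_exponential ?O J = card {d. d dvd e} ^ g"
    unfolding O.ideal_tau_exponential_eq[OF J v] supp using card by (simp add: v_def)
  have omega: "ideal_omega ?O J = g"
    unfolding ideal_omega_def ideal_prime_divisors_def O.prime_exponent_eq[OF J v] supp by (rule card)

  \<comment> \<open>This is where the odd degree enters: with \<open>e = 2\<close> and at most two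
    primes, \<open>J\<close> is the square of their product \<open>I\<close>, which would force an
    even degree.\<close>
  have "g \<ge> 3" if e: "e = 2"
  proof (rule ccontr)
    assume "\<not> g \<ge> 3"
    with \<open>g > 0\<close> consider "g = 1" | "g = 2" by linarith
    note g_cases = this
    define I where "I = (\<Otimes>\<^bsub>ideals_set ?O\<^esub> i\<in>{1..g}. P i)"
    have I: "ideal I ?O" unfolding I_def using ideal by (rule O.ideals_finprod_ideal)
    have P2: "P i [^]\<^bsub>ideals_set ?O\<^esub> e = P i \<otimes>\<^bsub>ideals_set ?O\<^esub> P i" if "i \<in> {1..g}" for i
      unfolding e numeral_2_eq_2 using ideal[OF that] M.l_one[of "P i"] by simp
    have "J = (\<Otimes>\<^bsub>ideals_set ?O\<^esub> i\<in>{1..g}. P i \<otimes>\<^bsub>ideals_set ?O\<^esub> P i)"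
      unfolding assms(12) using ideal O.ideal_prod_is_ideal P2 by (intro M.finprod_cong') auto
    also have "\<dots> = ideal_prod ?O I I"
      unfolding I_def using M.finprod_multf[of P "{1..g}" P] ideal by simp
    finally have sq: "ideal_prod ?O I I = PIdl\<^bsub>?O\<^esub> (of_nat p)" unfolding assms(7) by (rule sym)
    have incl: "I \<subseteq> P 1" "I \<subseteq> P g"
      unfolding I_def by (rule O.ideals_finprod_subset[OF _ one ideal] O.ideals_finprod_subset[OF _ gg ideal], simp, simp)+
    \<comment> \<open>For \<open>g = 1\<close> the two primes coincide and the square of
      \<open>P 1\<close> lies in \<open>P 1\<close>; for \<open>g = 2\<close> equality
      holds.\<close>
    have "ideal_prod ?O (P 1) (P g) \<subseteq> I"
      using g_cases
    proof cases
      case 1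
      then have "I = P 1" using ideal[OF one] O.ideal_prod_one[of "P 1"] by (simp add: I_def)
      then show ?thesis unfolding 1 using O.ideal_prod_inter[OF ideal[OF one] ideal[OF one]] by blast
    next
      case 2
      then have "{1..g} = {1, 2}" by auto
      then have "I = (\<Otimes>\<^bsub>ideals_set ?O\<^esub> i\<in>{1, 2}. P i)" by (simp only: I_def)
      also have "\<dots> = ideal_prod ?O (P 1) (P 2)"
        using ideal[OF one] ideal[OF gg] O.ideal_prod_one[of "P 2"] 2 by simp
      finally show ?thesis using 2 by simp
    qed
    from even_degree_if_prime_is_square[OF assms(1,6) I sq prime[OF one] prime[OF gg] incl(1,2) this]
    show False using assms(2,3) by simp
  qed
  then show ?thesis
    unfolding tau tau_e omega using ratio_inequality[OF \<open>e > 1\<close> \<open>g > 0\<close>] by blast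
qed

end
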